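(* A finitely generated subgroup of a Cayley p.f. linear-time computable group is Cayley p.f. linear-time computable.
   Context: Position-faithful one-tape Turing machine: a Turing machine with one semi-infinite tape (infinite in one direction only) whose left-most cell contains a special symbol $\boxplus$ which occurs only there and cannot be modified. On input $x\in\Sigma^*$ the initial tape content is $\boxplus x\boxdot^\infty$, where $\boxdot$ is a special blank symbol and $\Sigma\cap\{\boxplus,\boxdot\}=\varnothing$, and the head starts at $\boxplus$. The machine computes $f:\Sigma^*\to\Sigma^*$ if on every input $x\in\Sigma^*$ it eventually reaches an accepting state and halts with the tape having prefix $\boxplus f(x)\boxdot$ (no restriction on the tape content after this first $\boxdot$). A function $f:\Sigma^*\to\Sigma^*$ is position-faithful (p.f.) linear-time computable if it is computed by a deterministic position-faithful one-tape Turing machine in time linear in the input length. Let $G$ be a finitely generated group and $S=\{s_1,\dots,s_n\}\subset G$ a finite set of semigroup generators (every $g\in G$ is a product of elements of $S$). $G$ is Cayley p.f. linear-time computable if there exist a language $L\subseteq\Sigma^*$ (no restriction on the language class) over a finite alphabet $\Sigma$, a bijection $\psi:L\to G$ and p.f. linear-time computable functions $f_i:\Sigma^*\to\Sigma^*$, $i=1,\dots,n$, with $f_i(L)\subseteq L$ and $\psi(f_i(w))=\psi(w)s_i$ for all $w\in L$. This notion does not depend on the choice of $S$. *)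

theory Defs
  imports "HOL-Algebra.Generated_Groups"
begin

section \<open>Position-faithful one-tape Turing machines\<close>

text \<open>
  The two special symbols are separate constructors, so they are distinct from each other and from
  every input symbol \<open>Symbol a\<close>.
\<close>

datatype 'a tape_symbol = LeftEnd | Blank | Symbol 'a

datatype direction = MoveLeft | Stay | MoveRight

record ('q, 'a) machine =
  states :: "'q set"
  tape_alphabet :: "'a tape_symbol set"
  start :: 'q
  accepting :: "'q set"
  trans :: "'q \<Rightarrow> 'a tape_symbol \<Rightarrow> ('q \<times> 'a tape_symbol \<times> direction) option"

text \<open>
  Determinism is built into \<open>trans\<close> being a partial function; the machine halts exactly when no
  transition is defined.  In the last condition, the equivalence says that the left end marker is
  neither overwritten nor written anywhere else, and the implication that the head does not leave
  the semi-infinite tape.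
\<close>

definition pf_machine :: "'a set \<Rightarrow> ('q, 'a) machine \<Rightarrow> bool" where
  "pf_machine \<Sigma> M \<longleftrightarrow>
     finite (states M) \<and> finite (tape_alphabet M) \<and>
     LeftEnd \<in> tape_alphabet M \<and> Blank \<in> tape_alphabet M \<and>
     Symbol ` \<Sigma> \<subseteq> tape_alphabet M \<and>
     start M \<in> states M \<and> accepting M \<subseteq> states M \<and>
     (\<forall>q \<in> states M. \<forall>a \<in> tape_alphabet M. \<forall>q' b d.
        trans M q a = Some (q', b, d) \<longrightarrow>
          q' \<in> states M \<and> b \<in> tape_alphabet M \<and>
          (b = LeftEnd \<longleftrightarrow> a = LeftEnd) \<and> (a = LeftEnd \<longrightarrow> d \<noteq> MoveLeft))"

text \<open>A configuration consists of the state, the tape content and the head position.\<close>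

type_synonym ('q, 'a) config = "'q \<times> (nat \<Rightarrow> 'a tape_symbol) \<times> nat"

fun move_head :: "direction \<Rightarrow> nat \<Rightarrow> nat" where
  "move_head MoveLeft i = i - 1"
| "move_head Stay i = i"
| "move_head MoveRight i = Suc i"

inductive step :: "('q, 'a) machine \<Rightarrow> ('q, 'a) config \<Rightarrow> ('q, 'a) config \<Rightarrow> bool"
  for M :: "('q, 'a) machine" where
  "trans M q (tp i) = Some (q', b, d) \<Longrightarrow> step M (q, tp, i) (q', tp(i := b), move_head d i)"

definition initial_tape :: "'a list \<Rightarrow> nat \<Rightarrow> 'a tape_symbol" where
  "initial_tape x i =
     (if i = 0 then LeftEnd else if i \<le> length x then Symbol (x ! (i - 1)) else Blank)"

definition initial_config :: "('q, 'a) machine \<Rightarrow> 'a list \<Rightarrow> ('q, 'a) config" where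
  "initial_config M x = (start M, initial_tape x, 0)"

definition accepts_with_output ::
    "('q, 'a) machine \<Rightarrow> nat \<Rightarrow> 'a list \<Rightarrow> 'a list \<Rightarrow> bool" where
  "accepts_with_output M t x y \<longleftrightarrow>
     (\<exists>q tp i. (step M ^^ t) (initial_config M x) (q, tp, i) \<and>
        q \<in> accepting M \<and> trans M q (tp i) = None \<and>
        map tp [0..<length y + 2] = LeftEnd # map Symbol y @ [Blank])"

text \<open>
  The additive constant \<open>d\<close> only matters for the empty input.  States are natural numbers without
  loss of generality, since the state set is finite.
\<close>

definition pf_linear_time_computable :: "'a set \<Rightarrow> ('a list \<Rightarrow> 'a list) \<Rightarrow> bool" where
  "pf_linear_time_computable \<Sigma> f \<longleftrightarrow>
     f ` lists \<Sigma> \<subseteq> lists \<Sigma> \<and>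
     (\<exists>M :: (nat, 'a) machine. pf_machine \<Sigma> M \<and>
        (\<exists>c d :: nat. \<forall>x \<in> lists \<Sigma>. \<exists>t \<le> c * length x + d. accepts_with_output M t x (f x)))"


section \<open>Cayley position-faithful linear-time computable groups\<close>

text \<open>Generation as a semigroup: products are nonempty and inverses are not available.\<close>

definition semigroup_generators :: "('g, 'm) monoid_scheme \<Rightarrow> 'g set \<Rightarrow> bool" where
  "semigroup_generators G S \<longleftrightarrow>
     S \<subseteq> carrier G \<and>
     (\<forall>g \<in> carrier G. \<exists>ss \<in> lists S. ss \<noteq> [] \<and> g = foldr (mult G) ss (one G))"

text \<open>
  The functions are indexed by the generators themselves.  Symbols are natural numbers: up to
  renaming, every finite alphabet, together with the finitely many auxiliary tape symbols of the
  machines, is of this form.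
\<close>

definition cayley_pf_linear_time_computable_wrt ::
    "('g, 'm) monoid_scheme \<Rightarrow> 'g set \<Rightarrow> bool" where
  "cayley_pf_linear_time_computable_wrt G S \<longleftrightarrow>
     (\<exists>(\<Sigma> :: nat set) (L :: nat list set) (\<psi> :: nat list \<Rightarrow> 'g) (f :: 'g \<Rightarrow> nat list \<Rightarrow> nat list).
        finite \<Sigma> \<and> L \<subseteq> lists \<Sigma> \<and> bij_betw \<psi> L (carrier G) \<and>
        (\<forall>s \<in> S. pf_linear_time_computable \<Sigma> (f s) \<and> f s ` L \<subseteq> L \<and>
           (\<forall>w \<in> L. \<psi> (f s w) = \<psi> w \<otimes>\<^bsub>G\<^esub> s)))"

definition cayley_pf_linear_time_computable :: "('g, 'm) monoid_scheme \<Rightarrow> bool" where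
  "cayley_pf_linear_time_computable G \<longleftrightarrow>
     group G \<and>
     (\<exists>S. finite S \<and> semigroup_generators G S \<and> cayley_pf_linear_time_computable_wrt G S)"

text \<open>Generation as a group, i.e. with inverses allowed.\<close>

definition finitely_generated_subgroup :: "'g set \<Rightarrow> ('g, 'm) monoid_scheme \<Rightarrow> bool" where
  "finitely_generated_subgroup H G \<longleftrightarrow>
     subgroup H G \<and> (\<exists>A. finite A \<and> A \<subseteq> carrier G \<and> H = generate G A)"

end

theory Submission
  imports Defs
begin

text \<open>
  Normal forms for a subgroup \<open>H\<close> are those normal forms of \<open>G\<close> that represent elements of \<open>H\<close>;
  this is possible because the language of normal forms is arbitrary. Each of finitely many semigroup
  generators of \<open>H\<close> is a product \<open>s\<^sub>1 \<dots> s\<^sub>m\<close> of the given generators of \<open>G\<close>, so right multiplication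
  by it is the composition of the functions for \<open>s\<^sub>1\<close>, \<open>\<dots>\<close>, \<open>s\<^sub>m\<close>. It preserves the smaller language
  since \<open>H\<close> is closed under multiplication. Everything thus rests on closure of the position-faithful
  linear-time functions under composition (\<open>pf_linear_time_computable_comp\<close>).

  The obstacle to composition is that the first machine may leave arbitrary content behind the blank
  that ends its output, whereas the second one expects only blanks there. This content has to be
  erased, but its extent cannot be read off the tape if it contains blanks itself. The first machine
  is therefore simulated with a fresh symbol written in place of each blank. A true blank then
  marks an unvisited cell, and since the head moves by at most one cell at a time, the visited cells and
  the input form an initial segment of the tape (\<open>Run1_simulation\<close>). When the first machine halts, the
  head sweeps over this segment a bounded number of times: back to the left end, right to
  the first (fresh or true) blank, further right to the first true blank while erasing, and back to the
  left end (\<open>clean_up\<close>). The second machine then starts on exactly its initial tape.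

  The segment has length at most \<open>n + t + 1\<close>, where \<open>n\<close> is the length of the input and \<open>t\<close> is the running
  time of the first machine. Hence the sweeps take linear time, and the intermediate result
  has linear length, so that the second machine runs in time linear in \<open>n\<close> as well
  (\<open>compose_machine_accepts\<close>).
\<close>

section \<open>Runs on well-formed configurations\<close>

lemma pf_machine_basics:
  assumes "pf_machine \<Sigma> M"
  shows "finite (states M)" "finite (tape_alphabet M)" "LeftEnd \<in> tape_alphabet M"
    "Blank \<in> tape_alphabet M" "Symbol ` \<Sigma> \<subseteq> tape_alphabet M"
    "start M \<in> states M" "accepting M \<subseteq> states M"
  using assms unfolding pf_machine_def by - ((elim conjE, assumption)+)

lemma pf_machine_transD:
  assumes "pf_machine \<Sigma> M" "q \<in> states M" "a \<in> tape_alphabet M" "trans M q a = Some (q', b, d)"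
  shows "q' \<in> states M" "b \<in> tape_alphabet M" "b = LeftEnd \<longleftrightarrow> a = LeftEnd"
    "a = LeftEnd \<Longrightarrow> d \<noteq> MoveLeft"
proof -
  have "\<forall>q \<in> states M. \<forall>a \<in> tape_alphabet M. \<forall>q' b d. trans M q a = Some (q', b, d) \<longrightarrow>
          q' \<in> states M \<and> b \<in> tape_alphabet M \<and>
          (b = LeftEnd \<longleftrightarrow> a = LeftEnd) \<and> (a = LeftEnd \<longrightarrow> d \<noteq> MoveLeft)"
    using assms(1) unfolding pf_machine_def by (elim conjE)
  then have "q' \<in> states M \<and> b \<in> tape_alphabet M \<and>
      (b = LeftEnd \<longleftrightarrow> a = LeftEnd) \<and> (a = LeftEnd \<longrightarrow> d \<noteq> MoveLeft)"
    using assms(2-4) by blast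
  then show "q' \<in> states M" "b \<in> tape_alphabet M" "b = LeftEnd \<longleftrightarrow> a = LeftEnd"
    "a = LeftEnd \<Longrightarrow> d \<noteq> MoveLeft"
    by simp_all
qed

lemma pf_machineI:
  assumes "finite (states M)" "finite (tape_alphabet M)" "LeftEnd \<in> tape_alphabet M"
    "Blank \<in> tape_alphabet M" "Symbol ` \<Sigma> \<subseteq> tape_alphabet M"
    "start M \<in> states M" "accepting M \<subseteq> states M"
    and "\<And>q a q' b d. \<lbrakk>q \<in> states M; a \<in> tape_alphabet M; trans M q a = Some (q', b, d)\<rbrakk> \<Longrightarrow>
           q' \<in> states M \<and> b \<in> tape_alphabet M \<and>
           (b = LeftEnd \<longleftrightarrow> a = LeftEnd) \<and> (a = LeftEnd \<longrightarrow> d \<noteq> MoveLeft)"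
  shows "pf_machine \<Sigma> M"
proof -
  have "\<forall>q \<in> states M. \<forall>a \<in> tape_alphabet M. \<forall>q' b d. trans M q a = Some (q', b, d) \<longrightarrow>
          q' \<in> states M \<and> b \<in> tape_alphabet M \<and>
          (b = LeftEnd \<longleftrightarrow> a = LeftEnd) \<and> (a = LeftEnd \<longrightarrow> d \<noteq> MoveLeft)"
    by (intro ballI allI impI) (rule assms(8))
  with assms(1-7) show ?thesis
    unfolding pf_machine_def by (intro conjI)
qed

lemma accepts_with_outputE:
  assumes "accepts_with_output M t x y"
  obtains q tp i where "(step M ^^ t) (initial_config M x) (q, tp, i)"
    "q \<in> accepting M" "trans M q (tp i) = None"
    "map tp [0..<length y + 2] = LeftEnd # map Symbol y @ [Blank]"
  using assms unfolding accepts_with_output_def by (elim exE conjE) (rule that)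

text \<open>
  The conditions on the transitions of a machine only concern its own states and symbols. The
  invariant ensures that a run never leaves them, and that a leftward sweep can recognise
  position 0 by its symbol.
\<close>

definition wf_config :: "('q, 'a) machine \<Rightarrow> ('q, 'a) config \<Rightarrow> bool" where
  "wf_config M c \<longleftrightarrow> (case c of (q, tp, i) \<Rightarrow>
     q \<in> states M \<and> (\<forall>j. tp j \<in> tape_alphabet M) \<and> (\<forall>j. tp j = LeftEnd \<longleftrightarrow> j = 0))"

lemma accepts_with_outputI:
  assumes "(step M ^^ t) (start M, initial_tape x, 0) (q, tp, i)"
    "q \<in> accepting M" "trans M q (tp i) = None"
    "map tp [0..<length y + 2] = LeftEnd # map Symbol y @ [Blank]"
  shows "accepts_with_output M t x y"
  unfolding accepts_with_output_def initial_config_def using assms by (intro exI conjI)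

lemma wf_config_step:
  assumes "pf_machine \<Sigma> M" "wf_config M c" "step M c c'"
  shows "wf_config M c'"
  using assms(3)
proof cases
  case (1 q tp i q' b d)
  have "q \<in> states M" "tp i \<in> tape_alphabet M"
    using assms(2) 1 by (auto simp: wf_config_def)
  note pf_machine_transD[OF assms(1) this 1(3)]
  then show ?thesis
    using assms(2) 1 by (auto simp: wf_config_def)
qed

lemma wf_config_run:
  assumes "pf_machine \<Sigma> M" "wf_config M c" "(step M ^^ t) c c'"
  shows "wf_config M c'"
  using assms(3)
  by (induction t arbitrary: c')
     (use assms(2) in \<open>auto intro: wf_config_step[OF assms(1)]\<close>)

lemma wf_config_initial:
  assumes "pf_machine \<Sigma> M" "x \<in> lists \<Sigma>"
  shows "wf_config M (initial_config M x)"
proof -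
  have "x ! (j - 1) \<in> \<Sigma>" if "j \<le> length x" "j \<noteq> 0" for j
    using assms(2) that by (auto simp: in_lists_conv_set)
  then show ?thesis
    using pf_machine_basics[OF assms(1)]
    unfolding wf_config_def initial_config_def initial_tape_def by auto
qed


section \<open>Embedding one machine into another\<close>

definition map_state :: "('p \<Rightarrow> 'q) \<Rightarrow> ('p, 'a) config \<Rightarrow> ('q, 'a) config" where
  "map_state h = apfst h"

lemma map_state_simp [simp]: "map_state h (q, tp, i) = (h q, tp, i)"
  by (simp add: map_state_def)

text \<open>
  The equation also transfers undefined transitions, that is, halting. It leaves \<open>N\<close> free to have
  further states and symbols, so it covers both a renaming of the states and a second machine
  that runs as the last phase of a larger one.
\<close>

definition embeds_via :: "('p \<Rightarrow> 'q) \<Rightarrow> ('p, 'a) machine \<Rightarrow> ('q, 'a) machine \<Rightarrow> bool" where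
  "embeds_via h M N \<longleftrightarrow>
     (\<forall>q \<in> states M. \<forall>a \<in> tape_alphabet M. trans N (h q) a = map_option (apfst h) (trans M q a))"

lemma embeds_via_run:
  assumes "pf_machine \<Sigma> M" "embeds_via h M N" "wf_config M c" "(step M ^^ t) c c'"
  shows "(step N ^^ t) (map_state h c) (map_state h c')"
  using assms(4)
proof (induction t arbitrary: c')
  case 0
  then show ?case by simp
next
  case (Suc t)
  then obtain c1 where c1: "(step M ^^ t) c c1" "step M c1 c'"
    by auto
  have "wf_config M c1"
    using assms(1,3) c1(1) by (rule wf_config_run)
  with c1(2) have "step N (map_state h c1) (map_state h c')"
    using assms(2)
    by cases (auto simp: wf_config_def embeds_via_def intro!: step.intros)
  with Suc.IH[OF c1(1)] show ?case
    by auto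
qed

lemma embeds_via_accepts:
  assumes M: "pf_machine \<Sigma> M" and "embeds_via h M N"
    and "h ` accepting M \<subseteq> accepting N"
    and "x \<in> lists \<Sigma>" and "accepts_with_output M t x y"
  obtains q tp i where "(step N ^^ t) (h (start M), initial_tape x, 0) (q, tp, i)"
    "q \<in> accepting N" "trans N q (tp i) = None"
    "map tp [0..<length y + 2] = LeftEnd # map Symbol y @ [Blank]"
proof -
  obtain q tp i where run: "(step M ^^ t) (initial_config M x) (q, tp, i)"
    and q: "q \<in> accepting M" "trans M q (tp i) = None"
    and y: "map tp [0..<length y + 2] = LeftEnd # map Symbol y @ [Blank]"
    using assms(5) by (rule accepts_with_outputE)
  have "wf_config M (initial_config M x)"
    using assms(1,4) by (rule wf_config_initial)
  note wf = this wf_config_run[OF M this run]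
  have "(step N ^^ t) (h (start M), initial_tape x, 0) (h q, tp, i)"
    using embeds_via_run[OF M assms(2) wf(1) run] by (simp add: initial_config_def)
  moreover have "trans N (h q) (tp i) = None"
    using assms(2) q(2) wf(2) by (simp add: wf_config_def embeds_via_def)
  moreover have "h q \<in> accepting N"
    using q(1) assms(3) by blast
  ultimately show ?thesis
    using y by (intro that)
qed

section \<open>Machines with arbitrary state types\<close>

definition rename_states :: "('p \<Rightarrow> 'q) \<Rightarrow> ('p, 'a) machine \<Rightarrow> ('q, 'a) machine" where
  "rename_states h M =
     \<lparr>states = h ` states M, tape_alphabet = tape_alphabet M, start = h (start M),
      accepting = h ` accepting M,
      trans = (\<lambda>p a. map_option (apfst h) (trans M (inv_into (states M) h p) a))\<rparr>"

lemma pf_machine_rename_states: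
  assumes M: "pf_machine \<Sigma> M" and h: "inj_on h (states M)"
  shows "pf_machine \<Sigma> (rename_states h M)" (is "pf_machine \<Sigma> ?N")
proof (rule pf_machineI)
  fix q a q' b d
  assume q: "q \<in> states ?N" and a: "a \<in> tape_alphabet ?N" and tr: "trans ?N q a = Some (q', b, d)"
  obtain r where r: "r \<in> states M" "q = h r"
    using q by (auto simp: rename_states_def)
  then obtain p where p: "trans M r a = Some (p, b, d)" "q' = h p"
    using tr h by (auto simp: rename_states_def)
  have "a \<in> tape_alphabet M"
    using a by (simp add: rename_states_def)
  note pf_machine_transD[OF M r(1) this p(1)]
  then show "q' \<in> states ?N \<and> b \<in> tape_alphabet ?N \<and>
      (b = LeftEnd \<longleftrightarrow> a = LeftEnd) \<and> (a = LeftEnd \<longrightarrow> d \<noteq> MoveLeft)"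
    by (simp add: rename_states_def p(2))
qed (use pf_machine_basics[OF M] in \<open>auto simp: rename_states_def\<close>)

text \<open>
  A finite set of states of any type can be numbered. This permits the phases of a composite machine
  to be constructors of a datatype.
\<close>

lemma pf_linear_time_computableI:
  fixes M :: "('q, 'a) machine"
  assumes "f ` lists \<Sigma> \<subseteq> lists \<Sigma>" and M: "pf_machine \<Sigma> M"
    and acc: "\<And>x. x \<in> lists \<Sigma> \<Longrightarrow> \<exists>t \<le> c * length x + d. accepts_with_output M t x (f x)"
  shows "pf_linear_time_computable \<Sigma> f"
proof -
  obtain h :: "'q \<Rightarrow> nat" where h: "inj_on h (states M)"
    using finite_imp_inj_to_nat_seg[OF pf_machine_basics(1)[OF M]] by blast
  let ?N = "rename_states h M"
  have emb: "embeds_via h M ?N"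
    using h by (simp add: embeds_via_def rename_states_def inv_into_f_f)
  have "\<exists>t \<le> c * length x + d. accepts_with_output ?N t x (f x)" if x: "x \<in> lists \<Sigma>" for x
  proof -
    obtain t where t: "t \<le> c * length x + d" "accepts_with_output M t x (f x)"
      using acc[OF x] by blast
    have "h ` accepting M \<subseteq> accepting ?N"
      by (simp add: rename_states_def)
    then obtain q tp i where fin: "(step ?N ^^ t) (h (start M), initial_tape x, 0) (q, tp, i)"
      "q \<in> accepting ?N" "trans ?N q (tp i) = None"
      "map tp [0..<length (f x) + 2] = LeftEnd # map Symbol (f x) @ [Blank]"
      by (rule embeds_via_accepts[OF M emb _ x t(2)])
    have "start ?N = h (start M)"
      by (simp add: rename_states_def)
    then have "accepts_with_output ?N t x (f x)"
      using fin by (intro accepts_with_outputI) (simp_all only:)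
    with t(1) show ?thesis by blast
  qed
  moreover have "pf_machine \<Sigma> ?N"
    using M h by (rule pf_machine_rename_states)
  ultimately show ?thesis
    using assms(1) unfolding pf_linear_time_computable_def by blast
qed

lemma map_initial_tape:
  "map (initial_tape y) [0..<length y + 2] = LeftEnd # map Symbol y @ [Blank]"
proof (rule nth_equalityI)
  fix j assume "j < length (map (initial_tape y) [0..<length y + 2])"
  then have "j < length y + 2" by (simp del: upt_Suc)
  then show "map (initial_tape y) [0..<length y + 2] ! j = (LeftEnd # map Symbol y @ [Blank]) ! j"
    by (cases j) (auto simp: initial_tape_def nth_append simp del: upt_Suc)
qed simp

lemma pf_linear_time_computable_id:
  assumes "finite \<Sigma>"
  shows "pf_linear_time_computable \<Sigma> (\<lambda>x. x)"
proof (rule pf_linear_time_computableI[where c = 0 and d = 0])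
  let ?M = "\<lparr>states = {()}, tape_alphabet = {LeftEnd, Blank} \<union> Symbol ` \<Sigma>, start = (),
             accepting = {()}, trans = (\<lambda>_ _. None)\<rparr>"
  show "pf_machine \<Sigma> ?M"
    using assms by (intro pf_machineI) auto
  have "accepts_with_output ?M 0 x x" for x
    using map_initial_tape by (intro accepts_with_outputI[where tp = "initial_tape x"]) auto
  then show "\<exists>t \<le> 0 * length x + 0. accepts_with_output ?M t x x" for x
    by blast
qed auto


section \<open>Sweeping over the tape\<close>

lemma sweep_left:
  assumes "\<And>j. \<lbrakk>0 < j; j \<le> i\<rbrakk> \<Longrightarrow> trans M q (tp j) = Some (q, tp j, MoveLeft)"
  shows "(step M ^^ i) (q, tp, i) (q, tp, 0)"
  using assms
proof (induction i)
  case 0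
  then show ?case by simp
next
  case (Suc i)
  have "step M (q, tp, Suc i) (q, tp, i)"
    using step.intros[of M q tp "Suc i" q "tp (Suc i)" MoveLeft] Suc.prems by simp
  moreover have "(step M ^^ i) (q, tp, i) (q, tp, 0)"
    using Suc by simp
  ultimately show ?case
    by (rule relpowp_Suc_I2)
qed

text \<open>
  The symbols written are taken from the final tape \<open>tp'\<close>; this covers both scanning (\<open>tp' = tp\<close>) and
  erasing.
\<close>

lemma sweep_right:
  assumes "\<And>j. \<lbrakk>i \<le> j; j < i + n\<rbrakk> \<Longrightarrow> trans M q (tp j) = Some (q, tp' j, MoveRight)"
    and "\<And>j. \<not> (i \<le> j \<and> j < i + n) \<Longrightarrow> tp' j = tp j"
  shows "(step M ^^ n) (q, tp, i) (q, tp', i + n)"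
  using assms
proof (induction n arbitrary: tp')
  case 0
  then have "tp' = tp" by auto
  then show ?case by simp
next
  case (Suc n)
  let ?tp = "tp'(i + n := tp (i + n))"
  have "(step M ^^ n) (q, tp, i) (q, ?tp, i + n)"
    using Suc.prems by (intro Suc.IH) auto
  moreover have "step M (q, ?tp, i + n) (q, tp', i + Suc n)"
    using step.intros[of M q ?tp "i + n" q "tp' (i + n)" MoveRight] Suc.prems(1)[of "i + n"]
    by simp
  ultimately show ?case
    by (rule relpowp_Suc_I)
qed


section \<open>Composition of machines\<close>

datatype ('p, 'q) phase = Run1 'p | Rewind | Scan | Erase | Return | Run2 'q

text \<open>
  The symbol \<open>k\<close> stands for a blank written by the first machine, so \<open>encode\<close> is applied to what it
  writes and \<open>decode\<close> to what it reads.
\<close>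

definition decode :: "'a \<Rightarrow> 'a tape_symbol \<Rightarrow> 'a tape_symbol" where
  "decode k a = (if a = Symbol k then Blank else a)"

definition encode :: "'a \<Rightarrow> 'a tape_symbol \<Rightarrow> 'a tape_symbol" where
  "encode k a = (if a = Blank then Symbol k else a)"

text \<open>
  The tests for membership in the alphabets make the composite satisfy the conditions on machines:
  it has more symbols than either component, whose transitions on foreign symbols are
  unconstrained. The case of \<open>LeftEnd\<close> under \<open>Erase\<close> never arises in a run, but the left end marker
  must not be overwritten in any state.
\<close>

fun compose_trans ::
    "'a \<Rightarrow> ('p, 'a) machine \<Rightarrow> ('q, 'a) machine \<Rightarrow> ('p, 'q) phase \<Rightarrow> 'a tape_symbol
     \<Rightarrow> (('p, 'q) phase \<times> 'a tape_symbol \<times> direction) option" where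
  "compose_trans k M N (Run1 q) a =
     (if decode k a \<in> tape_alphabet M then
        case trans M q (decode k a) of
          None \<Rightarrow> Some (Rewind, a, Stay)
        | Some (q', b, d) \<Rightarrow> Some (Run1 q', encode k b, d)
      else None)"
| "compose_trans k M N Rewind a =
     (if a = LeftEnd then Some (Scan, a, Stay) else Some (Rewind, a, MoveLeft))"
| "compose_trans k M N Scan a =
     (if decode k a = Blank then Some (Erase, a, Stay) else Some (Scan, a, MoveRight))"
| "compose_trans k M N Erase a =
     (if a = Blank \<or> a = LeftEnd then Some (Return, a, Stay) else Some (Erase, Blank, MoveRight))"
| "compose_trans k M N Return a =
     (if a = LeftEnd then Some (Run2 (start N), a, Stay) else Some (Return, a, MoveLeft))"
| "compose_trans k M N (Run2 q) a =
     (if a \<in> tape_alphabet N then map_option (apfst Run2) (trans N q a) else None)"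

definition compose_machine ::
    "'a \<Rightarrow> ('p, 'a) machine \<Rightarrow> ('q, 'a) machine \<Rightarrow> (('p, 'q) phase, 'a) machine" where
  "compose_machine k M N =
     \<lparr>states = Run1 ` states M \<union> {Rewind, Scan, Erase, Return} \<union> Run2 ` states N,
      tape_alphabet = insert (Symbol k) (tape_alphabet M \<union> tape_alphabet N),
      start = Run1 (start M),
      accepting = Run2 ` accepting N,
      trans = compose_trans k M N\<rparr>"

lemma pf_machine_compose_machine:
  assumes M: "pf_machine \<Sigma> M" and N: "pf_machine \<Sigma> N"
  shows "pf_machine \<Sigma> (compose_machine k M N)"
    (is "pf_machine \<Sigma> ?C")
proof (rule pf_machineI)
  fix q a q' b d
  assume q: "q \<in> states ?C" and a: "a \<in> tape_alphabet ?C" and "trans ?C q a = Some (q', b, d)"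
  then have tr: "compose_trans k M N q a = Some (q', b, d)"
    by (simp add: compose_machine_def)
  show "q' \<in> states ?C \<and> b \<in> tape_alphabet ?C \<and>
        (b = LeftEnd \<longleftrightarrow> a = LeftEnd) \<and> (a = LeftEnd \<longrightarrow> d \<noteq> MoveLeft)"
  proof (cases q)
    case (Run1 p)
    with q have p: "p \<in> states M"
      by (auto simp: compose_machine_def)
    have dec: "decode k a \<in> tape_alphabet M"
      using tr Run1 by (auto split: if_splits)
    show ?thesis
    proof (cases "trans M p (decode k a)")
      case None
      then show ?thesis
        using tr Run1 dec a by (auto simp: compose_machine_def)
    next
      case (Some r)
      obtain p' b' d' where r: "r = (p', b', d')" by (cases r)
      note pf_machine_transD[OF M p dec Some[unfolded r]]
      then show ?thesis
        using tr Run1 dec Some r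
        by (auto simp: compose_machine_def decode_def encode_def split: if_splits)
    qed
  next
    case (Run2 p)
    with q have p: "p \<in> states N"
      by (auto simp: compose_machine_def)
    have a': "a \<in> tape_alphabet N" and "map_option (apfst Run2) (trans N p a) = Some (q', b, d)"
      using tr Run2 by (auto split: if_splits)
    then obtain p' where p': "trans N p a = Some (p', b, d)" "q' = Run2 p'"
      by auto
    note pf_machine_transD[OF N p a' p'(1)]
    then show ?thesis
      by (simp add: compose_machine_def p'(2))
  qed (use tr a pf_machine_basics[OF M] pf_machine_basics[OF N] in
      \<open>auto simp: compose_machine_def split: if_splits\<close>)
qed (use pf_machine_basics[OF M] pf_machine_basics[OF N] in \<open>auto simp: compose_machine_def\<close>)

text \<open>
  Here \<open>m\<close> is the length of the initial segment of nonblank cells. A step writes a nonblank symbol under the head,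
  which by \<open>i \<le> m\<close> is either inside the nonblank segment or directly behind it, so the segment stays
  contiguous and grows by at most one cell.
\<close>

lemma Run1_simulation:
  assumes M: "pf_machine \<Sigma> M" and k: "Symbol k \<notin> tape_alphabet M"
    and x: "x \<in> lists \<Sigma>"
    and run: "(step M ^^ t) (initial_config M x) (q, tp, i)"
  shows "\<exists>tp' m. (step (compose_machine k M N) ^^ t) (Run1 (start M), initial_tape x, 0) (Run1 q, tp', i)
           \<and> decode k \<circ> tp' = tp \<and> (\<forall>j. tp' j = Blank \<longleftrightarrow> m \<le> j) \<and> i \<le> m \<and> m \<le> length x + 1 + t"
  using run
proof (induction t arbitrary: q tp i)
  case 0
  have "tp j \<noteq> Symbol k" for j
    using wf_config_initial[OF M x] k 0 unfolding wf_config_def by (auto dest!: spec[of _ j])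
  then have "decode k \<circ> tp = tp"
    by (auto simp: decode_def)
  moreover have "\<forall>j. tp j = Blank \<longleftrightarrow> length x + 1 \<le> j"
    using 0 by (auto simp: initial_config_def initial_tape_def split: if_splits)
  moreover have "q = start M" "tp = initial_tape x" "i = 0"
    using 0 by (simp_all add: initial_config_def)
  ultimately show ?case
    by (intro exI[of _ tp] exI[of _ "length x + 1"]) simp
next
  case (Suc t)
  then obtain c where c: "(step M ^^ t) (initial_config M x) c" "step M c (q, tp, i)"
    by auto
  obtain p tq l where c_eq: "c = (p, tq, l)" by (cases c)
  have "wf_config M c"
    using wf_config_run[OF M wf_config_initial[OF M x] c(1)] .
  then have wf: "p \<in> states M" "tq l \<in> tape_alphabet M"
    by (auto simp: wf_config_def c_eq)
  obtain b d where tr: "trans M p (tq l) = Some (q, b, d)"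
    and eqs: "tp = tq(l := b)" "i = move_head d l"
    using c(2) by cases (auto simp: c_eq)
  have b: "b \<noteq> Symbol k"
    using pf_machine_transD(2)[OF M wf tr] k by blast
  obtain tq' m where IH:
    "(step (compose_machine k M N) ^^ t) (Run1 (start M), initial_tape x, 0) (Run1 p, tq', l)"
    "decode k \<circ> tq' = tq" "\<forall>j. tq' j = Blank \<longleftrightarrow> m \<le> j" "l \<le> m" "m \<le> length x + 1 + t"
    using Suc.IH c(1) c_eq by blast
  have "decode k (tq' l) = tq l"
    using IH(2) by auto
  then have "step (compose_machine k M N) (Run1 p, tq', l) (Run1 q, tq'(l := encode k b), i)"
    unfolding eqs using wf tr by (intro step.intros) (simp add: compose_machine_def)
  then have "(step (compose_machine k M N) ^^ Suc t) (Run1 (start M), initial_tape x, 0)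
               (Run1 q, tq'(l := encode k b), i)"
    using IH(1) by auto
  moreover have "decode k \<circ> tq'(l := encode k b) = tp"
    unfolding eqs IH(2)[symmetric] fun_eq_iff using b by (simp add: decode_def encode_def)
  moreover have "\<forall>j. (tq'(l := encode k b)) j = Blank \<longleftrightarrow> max m (Suc l) \<le> j"
    using IH(3,4) by (auto simp: encode_def)
  moreover have "i \<le> max m (Suc l)"
    using IH(4) by (cases d) (auto simp: eqs)
  moreover have "max m (Suc l) \<le> length x + 1 + Suc t"
    using IH(4,5) by simp
  ultimately show ?case
    by blast
qed

lemma output_tape_nth:
  assumes "map tp [0..<length y + 2] = LeftEnd # map Symbol y @ [Blank]" and "j \<le> length y + 1"
  shows "tp j = initial_tape y j"
  using assms unfolding map_initial_tape[symmetric] map_eq_conv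
  by (simp del: upt_Suc)

text \<open>
  The output ends at the first cell that decodes to a blank, and everything from there up to \<open>m\<close> is
  erased. The time consists of \<open>i\<close> steps of \<open>Rewind\<close>, \<open>m\<close> steps to the right, which \<open>Scan\<close> and \<open>Erase\<close>
  share, \<open>m\<close> steps of \<open>Return\<close>, and four changes of phase.
\<close>

lemma clean_up:
  assumes C: "C = compose_machine k M N"
    and out: "\<And>j. j \<le> length y + 1 \<Longrightarrow> decode k (tp j) = initial_tape y j"
    and left: "\<And>j. tp j = LeftEnd \<longleftrightarrow> j = 0"
    and blank: "\<And>j. tp j = Blank \<longleftrightarrow> m \<le> j"
  shows "length y < m"
    and "(step C ^^ (i + 2 * m + 4)) (Rewind, tp, i) (Run2 (start N), initial_tape y, 0)"
proof -
  have tC: "trans C = compose_trans k M N"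
    by (simp add: C compose_machine_def)
  have one: "(step C ^^ 1) (q, tp, i) (q', tp, i)" if "compose_trans k M N q (tp i) = Some (q', tp i, Stay)"
    for q q' i tp
    using step.intros[of C q tp i q' "tp i" Stay] that
    by (simp add: tC relpowp_1 del: One_nat_def)
  have nonblank: "decode k (tp j) \<noteq> Blank" if "j < length y + 1" for j
    using out[of j] that by (auto simp: initial_tape_def)
  have "tp (length y) \<noteq> Blank"
    using nonblank[of "length y"] by (auto simp: decode_def)
  then show m: "length y < m"
    using blank by simp
  have sep: "decode k (tp (length y + 1)) = Blank"
    using out[of "length y + 1"] by (simp add: initial_tape_def)
  have erased: "initial_tape y j = Blank" if "length y + 1 \<le> j" for j
    using that by (simp add: initial_tape_def)
  have kept: "initial_tape y j = tp j" if "j < length y + 1" for j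
    using out[of j] nonblank[of j] that by (auto simp: decode_def split: if_splits)
  have r1: "(step C ^^ i) (Rewind, tp, i) (Rewind, tp, 0)"
    using left by (intro sweep_left) (simp add: tC)
  have r2: "(step C ^^ 1) (Rewind, tp, 0) (Scan, tp, 0)"
    using left by (intro one) simp
  have "(step C ^^ (length y + 1)) (Scan, tp, 0) (Scan, tp, 0 + (length y + 1))"
    using nonblank by (intro sweep_right) (simp_all add: tC)
  then have r3: "(step C ^^ (length y + 1)) (Scan, tp, 0) (Scan, tp, length y + 1)"
    by (simp only: add_0)
  have r4: "(step C ^^ 1) (Scan, tp, length y + 1) (Erase, tp, length y + 1)"
    using sep by (intro one) simp
  have "(step C ^^ (m - (length y + 1))) (Erase, tp, length y + 1)
      (Erase, initial_tape y, length y + 1 + (m - (length y + 1)))"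
  proof (rule sweep_right)
    fix j assume "length y + 1 \<le> j" "j < length y + 1 + (m - (length y + 1))"
    then show "trans C Erase (tp j) = Some (Erase, initial_tape y j, MoveRight)"
      using erased left blank by (simp add: tC)
  next
    fix j assume "\<not> (length y + 1 \<le> j \<and> j < length y + 1 + (m - (length y + 1)))"
    then have "j < length y + 1 \<or> m \<le> j" "m \<le> j \<Longrightarrow> length y + 1 \<le> j"
      using m by auto
    then show "initial_tape y j = tp j"
      using kept erased blank by metis
  qed
  moreover have "length y + 1 + (m - (length y + 1)) = m"
    using m by simp
  ultimately have r5: "(step C ^^ (m - (length y + 1))) (Erase, tp, length y + 1)
      (Erase, initial_tape y, m)"
    by (simp only:)
  have r6: "(step C ^^ 1) (Erase, initial_tape y, m) (Return, initial_tape y, m)"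
    using erased m by (intro one) simp
  have r7: "(step C ^^ m) (Return, initial_tape y, m) (Return, initial_tape y, 0)"
    by (intro sweep_left) (simp add: tC initial_tape_def)
  have r8: "(step C ^^ 1) (Return, initial_tape y, 0) (Run2 (start N), initial_tape y, 0)"
    by (intro one) (simp add: initial_tape_def)
  have "(step C ^^ (i + (1 + (length y + 1 + (1 + (m - (length y + 1) + (1 + (m + 1))))))))
      (Rewind, tp, i) (Run2 (start N), initial_tape y, 0)"
    by (rule relpowp_trans[OF r1 relpowp_trans[OF r2 relpowp_trans[OF r3 relpowp_trans[OF r4
          relpowp_trans[OF r5 relpowp_trans[OF r6 relpowp_trans[OF r7 r8]]]]]]])
  moreover have "i + (1 + (length y + 1 + (1 + (m - (length y + 1) + (1 + (m + 1)))))) = i + 2 * m + 4"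
    using m by simp
  ultimately show "(step C ^^ (i + 2 * m + 4)) (Rewind, tp, i) (Run2 (start N), initial_tape y, 0)"
    by (simp only:)
qed

text \<open>
  With \<open>i \<le> m \<le> length x + 1 + t\<close>, the clean-up costs at most \<open>3 * (length x + 1 + t) + 4\<close> steps; one
  more step leads from the halting state of the first machine to \<open>Rewind\<close>. The bound on \<open>y\<close> holds because
  its symbols lie in the nonblank segment behind the left end marker.
\<close>

lemma compose_machine_accepts:
  assumes M: "pf_machine \<Sigma> M" and N: "pf_machine \<Sigma> N" and k: "Symbol k \<notin> tape_alphabet M"
    and x: "x \<in> lists \<Sigma>" and y: "y \<in> lists \<Sigma>"
    and accM: "accepts_with_output M t x y" and accN: "accepts_with_output N u y z"
  shows "length y \<le> length x + t"
    and "\<exists>v \<le> 4 * t + 3 * length x + 8 + u. accepts_with_output (compose_machine k M N) v x z"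
proof -
  let ?C = "compose_machine k M N"
  obtain q tp i where run: "(step M ^^ t) (initial_config M x) (q, tp, i)"
    and q: "trans M q (tp i) = None"
    and out: "map tp [0..<length y + 2] = LeftEnd # map Symbol y @ [Blank]"
    using accM by (rule accepts_with_outputE)
  have wf: "wf_config M (q, tp, i)"
    using wf_config_run[OF M wf_config_initial[OF M x] run] .
  obtain tp' m where r1: "(step ?C ^^ t) (Run1 (start M), initial_tape x, 0) (Run1 q, tp', i)"
    and tp: "decode k \<circ> tp' = tp" and blank: "\<And>j. tp' j = Blank \<longleftrightarrow> m \<le> j"
    and im: "i \<le> m" and m: "m \<le> length x + 1 + t"
    using Run1_simulation[OF M k x run] by blast
  have dec: "decode k (tp' j) = tp j" for j
    using tp by auto
  have "step ?C (Run1 q, tp', i) (Rewind, tp'(i := tp' i), move_head Stay i)"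
    using wf q by (intro step.intros) (simp add: dec compose_machine_def wf_config_def)
  then have r2: "(step ?C ^^ 1) (Run1 q, tp', i) (Rewind, tp', i)"
    by (simp only: relpowp_1 move_head.simps fun_upd_triv)
  have left: "tp' j = LeftEnd \<longleftrightarrow> j = 0" for j
  proof -
    have "tp' j = LeftEnd \<longleftrightarrow> decode k (tp' j) = LeftEnd"
      by (simp add: decode_def)
    also have "\<dots> \<longleftrightarrow> j = 0"
      using wf unfolding dec by (simp add: wf_config_def)
    finally show ?thesis .
  qed
  have out': "decode k (tp' j) = initial_tape y j" if "j \<le> length y + 1" for j
    unfolding dec using output_tape_nth[OF out that] .
  have ym: "length y < m"
    using out' left blank by (rule clean_up(1)[OF refl])
  have r3: "(step ?C ^^ (i + 2 * m + 4)) (Rewind, tp', i) (Run2 (start N), initial_tape y, 0)"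
    using out' left blank by (rule clean_up(2)[OF refl])
  show "length y \<le> length x + t"
    using ym m by simp
  have emb: "embeds_via Run2 N ?C"
    by (simp add: embeds_via_def compose_machine_def)
  have "Run2 ` accepting N \<subseteq> accepting ?C"
    by (simp add: compose_machine_def)
  then obtain q2 tp2 i2 where
    r4: "(step ?C ^^ u) (Run2 (start N), initial_tape y, 0) (q2, tp2, i2)"
    and fin: "q2 \<in> accepting ?C" "trans ?C q2 (tp2 i2) = None"
    "map tp2 [0..<length z + 2] = LeftEnd # map Symbol z @ [Blank]"
    by (rule embeds_via_accepts[OF N emb _ y accN])
  have "(step ?C ^^ (t + (1 + (i + 2 * m + 4 + u)))) (Run1 (start M), initial_tape x, 0) (q2, tp2, i2)"
    by (rule relpowp_trans[OF r1 relpowp_trans[OF r2 relpowp_trans[OF r3 r4]]])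
  then have "accepts_with_output ?C (t + (1 + (i + 2 * m + 4 + u))) x z"
    using fin by (intro accepts_with_outputI) (simp_all add: compose_machine_def)
  moreover have "t + (1 + (i + 2 * m + 4 + u)) \<le> 4 * t + 3 * length x + 8 + u"
    using im m by simp
  ultimately show "\<exists>v \<le> 4 * t + 3 * length x + 8 + u. accepts_with_output ?C v x z"
    by blast
qed

lemma pf_linear_time_computableE:
  assumes "pf_linear_time_computable \<Sigma> f"
  obtains M :: "(nat, 'a) machine" and c d where "f ` lists \<Sigma> \<subseteq> lists \<Sigma>" "pf_machine \<Sigma> M"
    "\<And>x. x \<in> lists \<Sigma> \<Longrightarrow> \<exists>t \<le> c * length x + d. accepts_with_output M t x (f x)"
  using assms unfolding pf_linear_time_computable_def by (elim conjE exE) (rule that, assumption, assumption, rule bspec)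

text \<open>
  An infinite type of symbols guarantees a fresh symbol outside the finite alphabet of the first
  machine.
\<close>

theorem pf_linear_time_computable_comp:
  fixes f g :: "'a list \<Rightarrow> 'a list"
  assumes "infinite (UNIV :: 'a set)"
    and f: "pf_linear_time_computable \<Sigma> f" and g: "pf_linear_time_computable \<Sigma> g"
  shows "pf_linear_time_computable \<Sigma> (g \<circ> f)"
proof -
  obtain M :: "(nat, 'a) machine" and c1 d1 where f_lists: "f ` lists \<Sigma> \<subseteq> lists \<Sigma>"
    and M: "pf_machine \<Sigma> M"
    and accM: "\<And>x. x \<in> lists \<Sigma> \<Longrightarrow> \<exists>t \<le> c1 * length x + d1. accepts_with_output M t x (f x)"
    using f by (rule pf_linear_time_computableE) blast
  obtain N :: "(nat, 'a) machine" and c2 d2 where g_lists: "g ` lists \<Sigma> \<subseteq> lists \<Sigma>"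
    and N: "pf_machine \<Sigma> N"
    and accN: "\<And>x. x \<in> lists \<Sigma> \<Longrightarrow> \<exists>t \<le> c2 * length x + d2. accepts_with_output N t x (g x)"
    using g by (rule pf_linear_time_computableE) blast
  have fl: "f x \<in> lists \<Sigma>" if "x \<in> lists \<Sigma>" for x
    using f_lists that by blast
  have "finite (Symbol -` tape_alphabet M)"
    using pf_machine_basics(2)[OF M] by (intro finite_vimageI) (auto simp: inj_def)
  then obtain k where k: "Symbol k \<notin> tape_alphabet M"
    using ex_new_if_finite[OF assms(1)] by blast
  \<comment> \<open>These result from substituting \<open>t \<le> c1 * n + d1\<close> and \<open>u \<le> c2 * (n + t) + d2\<close> into the bound
    \<open>4 * t + 3 * n + 8 + u\<close> for the composite machine, where \<open>n\<close> is the length of the input.\<close>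
  define c d where "c = 4 * c1 + 3 + c2 * (c1 + 1)" and "d = 4 * d1 + 8 + c2 * d1 + d2"
  have "\<exists>v \<le> c * length x + d. accepts_with_output (compose_machine k M N) v x ((g \<circ> f) x)"
    if x: "x \<in> lists \<Sigma>" for x
  proof -
    obtain t where t: "t \<le> c1 * length x + d1" "accepts_with_output M t x (f x)"
      using accM[OF x] by blast
    obtain u where u: "u \<le> c2 * length (f x) + d2" "accepts_with_output N u (f x) (g (f x))"
      using accN[OF fl[OF x]] by blast
    note comp = compose_machine_accepts[OF M N k x fl[OF x] t(2) u(2)]
    obtain v where v: "v \<le> 4 * t + 3 * length x + 8 + u"
      "accepts_with_output (compose_machine k M N) v x (g (f x))"
      using comp(2) by blast
    have "u \<le> c2 * (length x + (c1 * length x + d1)) + d2"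
      using u(1) comp(1) t(1) by (meson add_le_mono le_refl le_trans mult_le_mono)
    then have "v \<le> c * length x + d"
      using v(1) t(1) unfolding c_def d_def by (simp add: algebra_simps)
    with v(2) show ?thesis by auto
  qed
  note acc = this
  have "(g \<circ> f) ` lists \<Sigma> \<subseteq> lists \<Sigma>"
    using fl g_lists by (simp add: image_subset_iff)
  then show ?thesis
    using pf_machine_compose_machine[OF M N] acc by (rule pf_linear_time_computableI)
qed


section \<open>Finitely generated subgroups\<close>

text \<open>
  Adding the inverses turns group generators into semigroup generators. The identity is added as well
  because it must be a nonempty product even if \<open>A\<close> is empty.
\<close>

lemma generate_imp_semigroup_product:
  assumes "group G" "A \<subseteq> carrier G" "h \<in> generate G A"
  defines "T \<equiv> insert \<one>\<^bsub>G\<^esub> (A \<union> m_inv G ` A)"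
  shows "\<exists>ss \<in> lists T. ss \<noteq> [] \<and> h = foldr (mult G) ss \<one>\<^bsub>G\<^esub>"
proof -
  interpret group G by fact
  have T: "T \<subseteq> carrier G"
    using assms(2) by (auto simp: T_def)
  have closed: "foldr (mult G) ss \<one>\<^bsub>G\<^esub> \<in> carrier G" if "ss \<in> lists T" for ss
    using that T by (induction ss) auto
  have append: "foldr (mult G) (ss @ us) \<one>\<^bsub>G\<^esub> = foldr (mult G) ss \<one>\<^bsub>G\<^esub> \<otimes>\<^bsub>G\<^esub> foldr (mult G) us \<one>\<^bsub>G\<^esub>"
    if "ss \<in> lists T" "us \<in> lists T" for ss us
    using that(1)
  proof (induction ss)
    case (Cons s ss)
    then have "s \<in> carrier G" using T by auto
    with Cons closed[of ss] closed[OF that(2)] show ?case by (simp add: m_assoc)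
  qed (use closed[OF that(2)] in simp)
  have single: "\<exists>ss \<in> lists T. ss \<noteq> [] \<and> a = foldr (mult G) ss \<one>\<^bsub>G\<^esub>" if "a \<in> T" for a
    using that T by (intro bexI[of _ "[a]"]) auto
  show ?thesis
    using assms(3)
  proof (induction rule: generate.induct)
    case (eng h1 h2)
    then obtain ss us where "ss \<in> lists T" "ss \<noteq> []" "h1 = foldr (mult G) ss \<one>\<^bsub>G\<^esub>"
      "us \<in> lists T" "h2 = foldr (mult G) us \<one>\<^bsub>G\<^esub>"
      by blast
    then show ?case
      using append by (intro bexI[of _ "ss @ us"]) auto
  qed (rule single, simp add: T_def)+
qed

text \<open>
  The functions for the factors are applied from left to right, since
  \<open>g (s\<^sub>1 s\<^sub>2) = (g s\<^sub>1) s\<^sub>2\<close>.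
\<close>

lemma right_mult_by_product_computable:
  assumes "group G" and S: "S \<subseteq> carrier G"
    and L: "finite \<Sigma>" "bij_betw \<psi> L (carrier G)"
    and f: "\<And>s. s \<in> S \<Longrightarrow> pf_linear_time_computable \<Sigma> (f s) \<and> f s ` L \<subseteq> L \<and>
              (\<forall>w \<in> L. \<psi> (f s w) = \<psi> w \<otimes>\<^bsub>G\<^esub> s)"
    and ss: "ss \<in> lists S"
  shows "\<exists>F :: nat list \<Rightarrow> nat list. pf_linear_time_computable \<Sigma> F \<and> F ` L \<subseteq> L \<and>
           (\<forall>w \<in> L. \<psi> (F w) = \<psi> w \<otimes>\<^bsub>G\<^esub> foldr (mult G) ss \<one>\<^bsub>G\<^esub>)"
proof -
  interpret group G by fact
  have psi: "\<psi> w \<in> carrier G" if "w \<in> L" for w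
    using L(2) that by (auto simp: bij_betw_def)
  show ?thesis
    using ss
  proof (induction ss)
    case Nil
    then show ?case
      using pf_linear_time_computable_id[OF L(1)] psi by (intro exI[of _ "\<lambda>x. x"]) auto
  next
    case (Cons s ss)
    then obtain F where F: "pf_linear_time_computable \<Sigma> F" "F ` L \<subseteq> L"
      "\<And>w. w \<in> L \<Longrightarrow> \<psi> (F w) = \<psi> w \<otimes>\<^bsub>G\<^esub> foldr (mult G) ss \<one>\<^bsub>G\<^esub>"
      by blast
    have s: "s \<in> S" and "set ss \<subseteq> S"
      using Cons.hyps by auto
    then have prod: "foldr (mult G) ss \<one>\<^bsub>G\<^esub> \<in> carrier G"
      using S by (induction ss) auto
    have "\<psi> ((F \<circ> f s) w) = \<psi> w \<otimes>\<^bsub>G\<^esub> foldr (mult G) (s # ss) \<one>\<^bsub>G\<^esub>" if "w \<in> L" for w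
    proof -
      have "s \<in> carrier G" "f s w \<in> L" "\<psi> (f s w) = \<psi> w \<otimes>\<^bsub>G\<^esub> s"
        using that f[OF s] s S by auto
      with that F(3)[of "f s w"] psi prod show ?thesis
        by (simp add: m_assoc)
    qed
    moreover have "pf_linear_time_computable \<Sigma> (F \<circ> f s)"
      using f[OF s] F(1) by (intro pf_linear_time_computable_comp) auto
    moreover have "(F \<circ> f s) ` L \<subseteq> L"
      using f[OF s] F(2) by auto
    ultimately show ?case by blast
  qed
qed

theorem theorem7:
  fixes G :: "('g, 'm) monoid_scheme" and H :: "'g set"
  assumes "cayley_pf_linear_time_computable G"
    and "finitely_generated_subgroup H G"
  shows "cayley_pf_linear_time_computable (G\<lparr>carrier := H\<rparr>)"
proof -
  interpret group G
    using assms(1) by (simp add: cayley_pf_linear_time_computable_def)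
  obtain S where S: "semigroup_generators G S" "cayley_pf_linear_time_computable_wrt G S"
    using assms(1) unfolding cayley_pf_linear_time_computable_def by (elim conjE exE) (rule that)
  obtain \<Sigma> :: "nat set" and L \<psi> f where L: "finite \<Sigma>" "L \<subseteq> lists \<Sigma>" "bij_betw \<psi> L (carrier G)"
    and f: "\<And>s. s \<in> S \<Longrightarrow> pf_linear_time_computable \<Sigma> (f s) \<and> f s ` L \<subseteq> L \<and>
              (\<forall>w \<in> L. \<psi> (f s w) = \<psi> w \<otimes>\<^bsub>G\<^esub> s)"
    using S(2) unfolding cayley_pf_linear_time_computable_wrt_def
    by (elim conjE exE) (rule that, assumption, assumption, assumption, rule bspec)
  obtain A where H: "subgroup H G" and A: "finite A" "A \<subseteq> carrier G" "H = generate G A"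
    using assms(2) unfolding finitely_generated_subgroup_def by (elim conjE exE) (rule that)
  define T where "T = insert \<one>\<^bsub>G\<^esub> (A \<union> m_inv G ` A)"
  have TH: "T \<subseteq> H"
    unfolding T_def A(3) by (auto intro: generate.intros)
  have HG: "H \<subseteq> carrier G"
    using H by (rule subgroup.subset)
  have "\<exists>F. pf_linear_time_computable \<Sigma> F \<and> F ` L \<subseteq> L \<and> (\<forall>w \<in> L. \<psi> (F w) = \<psi> w \<otimes>\<^bsub>G\<^esub> a)"
    if a: "a \<in> carrier G" for a
  proof -
    obtain ss where "ss \<in> lists S" "a = foldr (mult G) ss \<one>\<^bsub>G\<^esub>"
      using S(1) a unfolding semigroup_generators_def by blast
    then show ?thesis
      using right_mult_by_product_computable[OF group_axioms _ L(1,3) f, where ss = ss] S(1)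
      unfolding semigroup_generators_def by blast
  qed
  then obtain F where F: "\<And>a. a \<in> carrier G \<Longrightarrow> pf_linear_time_computable \<Sigma> (F a) \<and>
      F a ` L \<subseteq> L \<and> (\<forall>w \<in> L. \<psi> (F a w) = \<psi> w \<otimes>\<^bsub>G\<^esub> a)"
    by metis
  define K where "K = {w \<in> L. \<psi> w \<in> H}"
  have bij: "bij_betw \<psi> K H"
    using L(3) HG unfolding K_def bij_betw_def by (auto intro: inj_on_subset)
  have "cayley_pf_linear_time_computable_wrt (G\<lparr>carrier := H\<rparr>) T"
    unfolding cayley_pf_linear_time_computable_wrt_def
  proof (intro exI conjI ballI)
    show "finite \<Sigma>" by (rule L(1))
    show "K \<subseteq> lists \<Sigma>" using L(2) by (auto simp: K_def)
    show "bij_betw \<psi> K (carrier (G\<lparr>carrier := H\<rparr>))" using bij by simp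
    fix a assume "a \<in> T"
    then have a: "a \<in> H" "a \<in> carrier G" using TH HG by auto
    show "pf_linear_time_computable \<Sigma> (F a)" using F[OF a(2)] by simp
    show "F a ` K \<subseteq> K"
      using F[OF a(2)] subgroup.m_closed[OF H _ a(1)] by (auto simp: K_def)
    show "\<psi> (F a w) = \<psi> w \<otimes>\<^bsub>G\<lparr>carrier := H\<rparr>\<^esub> a" if "w \<in> K" for w
      using F[OF a(2)] that by (simp add: K_def)
  qed
  moreover have "semigroup_generators (G\<lparr>carrier := H\<rparr>) T"
    using TH generate_imp_semigroup_product[OF group_axioms A(2)]
    unfolding semigroup_generators_def T_def A(3) by simp
  moreover have "finite T"
    using A(1) by (simp add: T_def)
  moreover have "group (G\<lparr>carrier := H\<rparr>)"
    using H by (rule subgroup_imp_group)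
  ultimately show ?thesis
    unfolding cayley_pf_linear_time_computable_def by blast
qed

end
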